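(* Let $F(\mathcal R)$ be the free category on a directed graph $\mathcal R$ of guarded rules, let $(V,\star,1,\le)$ be an ordered error algebra, and let $r\mapsto\beta(r)\in V$ be an assignment on the generating rules (arrows of the graph). The generator assignment extends uniquely to a functor $$\beta:F(\mathcal R)\longrightarrow BV,$$ where $BV$ is the one-object category whose endomorphism monoid is $V$. Suppose in addition that a predicate $\operatorname{Sound}(w,v)$, relating paths $w$ of $F(\mathcal R)$ (on their guards) and elements $v\in V$, satisfies (S1) $\operatorname{Sound}(1_x,1)$ for every object $x$; (S2) $\operatorname{Sound}(r,\beta(r))$ for every generating rule $r$ on its guard; (S3) if $\operatorname{Sound}(w_1,v_1)$ and $\operatorname{Sound}(w_2,v_2)$ for a composable pair, then $\operatorname{Sound}(w_2w_1,v_2\star v_1)$ on the composite guard. Then every empty path $1_x$ is sound with certificate $1$, and every nonempty path $w=r_k\cdots r_1$ is sound with certificate $$\beta(w)=\beta(r_k)\star\cdots\star\beta(r_1).$$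
   Context: An ordered error algebra is a unital ordered monoid $(V,\star,1,\le)$: $\star$ is associative with unit $1$ and monotone in each variable; commutativity is not assumed. Composition in $BV$ is $v_2\circ v_1=v_2\star v_1$. A path $w$ "is sound with certificate $v$" means $\operatorname{Sound}(w,v)$ holds. $w_2w_1$ denotes the composite path, first $w_1$, then $w_2$; $1_x$ is the empty path at the object $x$. A guard is the subcollection of states on which a rule (or composite of rules) is defined and its certificate is asserted; the application-specific predicate $\operatorname{Sound}$ refers to the guard of the path concerned. *)

theory Defs
  imports "Graph_Theory.Arc_Walk" "HOL-Library.FuncSet"
begin

section \<open>Ordered error algebras\<close>

class ordered_error_algebra = monoid_mult + order +
  assumes error_mult_left_mono: "a \<le> b \<Longrightarrow> c * a \<le> c * b"
    and error_mult_right_mono: "a \<le> b \<Longrightarrow> a * c \<le> b * c"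


section \<open>Categories and functors\<close>

record ('o, 'a) cat =
  Obj :: "'o set"
  Arr :: "'a set"
  Dom :: "'a \<Rightarrow> 'o"
  Cod :: "'a \<Rightarrow> 'o"
  Id :: "'o \<Rightarrow> 'a"
  Comp :: "'a \<Rightarrow> 'a \<Rightarrow> 'a"  \<comment> \<open>\<open>Comp C g f\<close> is \<open>g \<circ> f\<close>: first \<open>f\<close>, then \<open>g\<close>\<close>

locale category =
  fixes C :: "('o, 'a) cat"
  assumes Dom_in: "f \<in> Arr C \<Longrightarrow> Dom C f \<in> Obj C"
    and Cod_in: "f \<in> Arr C \<Longrightarrow> Cod C f \<in> Obj C"
    and Id_in: "x \<in> Obj C \<Longrightarrow> Id C x \<in> Arr C"
    and Dom_Id: "x \<in> Obj C \<Longrightarrow> Dom C (Id C x) = x"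
    and Cod_Id: "x \<in> Obj C \<Longrightarrow> Cod C (Id C x) = x"
    and Comp_in: "\<lbrakk>f \<in> Arr C; g \<in> Arr C; Cod C f = Dom C g\<rbrakk> \<Longrightarrow> Comp C g f \<in> Arr C"
    and Dom_Comp: "\<lbrakk>f \<in> Arr C; g \<in> Arr C; Cod C f = Dom C g\<rbrakk> \<Longrightarrow> Dom C (Comp C g f) = Dom C f"
    and Cod_Comp: "\<lbrakk>f \<in> Arr C; g \<in> Arr C; Cod C f = Dom C g\<rbrakk> \<Longrightarrow> Cod C (Comp C g f) = Cod C g"
    and Comp_Id_right: "f \<in> Arr C \<Longrightarrow> Comp C f (Id C (Dom C f)) = f"
    and Comp_Id_left: "f \<in> Arr C \<Longrightarrow> Comp C (Id C (Cod C f)) f = f"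
    and Comp_assoc: "\<lbrakk>f \<in> Arr C; g \<in> Arr C; h \<in> Arr C; Cod C f = Dom C g; Cod C g = Dom C h\<rbrakk>
          \<Longrightarrow> Comp C h (Comp C g f) = Comp C (Comp C h g) f"

record ('o, 'a, 'p, 'b) fmaps =
  obj_map :: "'o \<Rightarrow> 'p"
  arr_map :: "'a \<Rightarrow> 'b"

text \<open>
  The maps of a functor are extensional (they take the value \<^const>\<open>undefined\<close> outside
  the source category), so that equality in the record type is equality of functors.
\<close>

locale is_functor = source: category C + target: category D
  for C :: "('o, 'a) cat" and D :: "('p, 'b) cat" and F :: "('o, 'a, 'p, 'b) fmaps" +
  assumes obj_map_in: "obj_map F \<in> Obj C \<rightarrow>\<^sub>E Obj D"
    and arr_map_in: "arr_map F \<in> Arr C \<rightarrow>\<^sub>E Arr D"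
    and map_Dom: "f \<in> Arr C \<Longrightarrow> Dom D (arr_map F f) = obj_map F (Dom C f)"
    and map_Cod: "f \<in> Arr C \<Longrightarrow> Cod D (arr_map F f) = obj_map F (Cod C f)"
    and map_Id: "x \<in> Obj C \<Longrightarrow> arr_map F (Id C x) = Id D (obj_map F x)"
    and map_Comp: "\<lbrakk>f \<in> Arr C; g \<in> Arr C; Cod C f = Dom C g\<rbrakk>
          \<Longrightarrow> arr_map F (Comp C g f) = Comp D (arr_map F g) (arr_map F f)"

definition one_object_cat :: "(unit, 'v::monoid_mult) cat" where
  "one_object_cat = \<lparr>Obj = UNIV, Arr = UNIV, Dom = (\<lambda>_. ()), Cod = (\<lambda>_. ()),
     Id = (\<lambda>_. 1), Comp = (\<lambda>v\<^sub>2 v\<^sub>1. v\<^sub>2 * v\<^sub>1)\<rparr>"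

lemma category_one_object_cat: "category one_object_cat"
  by unfold_locales (simp_all add: one_object_cat_def mult.assoc)


section \<open>The free category on a directed graph\<close>

text \<open>
  A path is a triple of its source, its list of arcs in the order of traversal, and its target;
  the path written \<open>r\<^sub>k \<cdots> r\<^sub>1\<close> thus has the arc list \<open>[r\<^sub>1, \<dots>, r\<^sub>k]\<close>.
\<close>

type_synonym ('x, 'r) path = "'x \<times> 'r list \<times> 'x"

definition free_category :: "('x, 'r) pre_digraph \<Rightarrow> ('x, ('x, 'r) path) cat" where
  "free_category R = \<lparr>Obj = verts R, Arr = {(x, p, y). pre_digraph.awalk R x p y},
     Dom = (\<lambda>(x, p, y). x), Cod = (\<lambda>(x, p, y). y), Id = (\<lambda>x. (x, [], x)),
     Comp = (\<lambda>(y', q, z) (x, p, y). (x, p @ q, z))\<rparr>"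

definition generator :: "('x, 'r) pre_digraph \<Rightarrow> 'r \<Rightarrow> ('x, 'r) path" where
  "generator R r = (tail R r, [r], head R r)"

lemma category_free_category:
  assumes "wf_digraph R"
  shows "category (free_category R)"
proof -
  interpret wf_digraph R by fact
  show ?thesis
    by unfold_locales
      (auto simp: free_category_def awalk_Nil_iff awalk_hd_in_verts awalk_last_in_verts
        intro: awalk_appendI)
qed

lemma generator_in_free_category:
  assumes "wf_digraph R" "r \<in> arcs R"
  shows "generator R r \<in> Arr (free_category R)"
    and "Dom (free_category R) (generator R r) = tail R r"
    and "Cod (free_category R) (generator R r) = head R r"
proof -
  interpret wf_digraph R by fact
  show "generator R r \<in> Arr (free_category R)"
    using assms by (auto simp: free_category_def generator_def awalk_def)
qed (simp_all add: free_category_def generator_def)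


section \<open>Guarded rules\<close>

text \<open>
  Each object \<open>x\<close> carries a collection \<open>St x\<close> of states, and each rule \<open>r\<close> is a partial map
  \<open>act r\<close> from the states of its source to those of its target. The guard of a rule is the
  domain of this partial map, and the guard of a path is the domain of the composite partial map.
\<close>

locale guarded_rules = wf_digraph R
  for R :: "('x, 'r) pre_digraph" +
  fixes St :: "'x \<Rightarrow> 's set" and act :: "'r \<Rightarrow> ('s \<rightharpoonup> 's)"
  assumes dom_act: "r \<in> arcs R \<Longrightarrow> dom (act r) \<subseteq> St (tail R r)"
    and ran_act: "r \<in> arcs R \<Longrightarrow> ran (act r) \<subseteq> St (head R r)"

fun path_act :: "('x, 'r) pre_digraph \<Rightarrow> ('x \<Rightarrow> 's set) \<Rightarrow> ('r \<Rightarrow> ('s \<rightharpoonup> 's))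
    \<Rightarrow> ('x, 'r) path \<Rightarrow> ('s \<rightharpoonup> 's)" where
  "path_act R St act (x, [], y) = Some |` St x"
| "path_act R St act (x, r # p, y) = path_act R St act (head R r, p, y) \<circ>\<^sub>m act r"

definition guard :: "('x, 'r) pre_digraph \<Rightarrow> ('x \<Rightarrow> 's set) \<Rightarrow> ('r \<Rightarrow> ('s \<rightharpoonup> 's))
    \<Rightarrow> ('x, 'r) path \<Rightarrow> 's set" where
  "guard R St act w = dom (path_act R St act w)"

context guarded_rules
begin

lemma guard_Id: "guard R St act (Id (free_category R) x) = St x"
  by (simp add: guard_def free_category_def)

lemma path_act_generator:
  assumes "r \<in> arcs R"
  shows "path_act R St act (generator R r) = act r"
proof
  fix s
  show "path_act R St act (generator R r) s = act r s"
    using ran_act[OF assms]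
    by (auto simp: generator_def map_comp_def restrict_map_def ran_def split: option.split)
qed

lemma guard_generator: "r \<in> arcs R \<Longrightarrow> guard R St act (generator R r) = dom (act r)"
  by (simp add: guard_def path_act_generator)

lemma path_act_dom: "awalk x p y \<Longrightarrow> dom (path_act R St act (x, p, y)) \<subseteq> St x"
proof (cases p)
  case (Cons r q)
  moreover assume "awalk x p y"
  ultimately have "r \<in> arcs R" "tail R r = x" by (auto simp: awalk_def)
  then show ?thesis using dom_act[of r] Cons
    by (auto simp: map_comp_def dom_def split: option.splits)
qed (auto)

lemma path_act_append:
  "\<lbrakk>awalk x p y; awalk y q z\<rbrakk> \<Longrightarrow>
    path_act R St act (x, p @ q, z) = path_act R St act (y, q, z) \<circ>\<^sub>m path_act R St act (x, p, y)"
proof (induction p arbitrary: x)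
  case Nil
  then have xy: "x = y" by (simp add: awalk_Nil_iff)
  show ?case
  proof
    fix s
    show "path_act R St act (x, [] @ q, z) s
      = (path_act R St act (y, q, z) \<circ>\<^sub>m path_act R St act (x, [], y)) s"
      using path_act_dom[OF Nil.prems(2)] xy
      by (auto simp: map_comp_def restrict_map_def dom_def)
  qed
next
  case (Cons r p)
  then have "awalk (head R r) p y" by (simp add: awalk_Cons_iff)
  then show ?case using Cons by (auto simp: map_comp_def fun_eq_iff split: option.split)
qed

lemma guard_Comp:
  assumes "w\<^sub>1 \<in> Arr (free_category R)" "w\<^sub>2 \<in> Arr (free_category R)"
    and "Cod (free_category R) w\<^sub>1 = Dom (free_category R) w\<^sub>2"
  shows "guard R St act (Comp (free_category R) w\<^sub>2 w\<^sub>1)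
    = {s \<in> guard R St act w\<^sub>1. the (path_act R St act w\<^sub>1 s) \<in> guard R St act w\<^sub>2}"
  using assms
  by (auto simp: free_category_def guard_def path_act_append map_comp_def dom_def
      split: option.splits)

end

end

theory Submission
  imports Defs
begin

text \<open>
  A path is nothing but a finite sequence of composable rules, so every arrow of the free category
  arises from an identity by precomposing generators one at a time, and a property of arrows can be
  proved by induction along this construction (\<open>free_category_induct\<close>). This settles uniqueness
  and soundness at the same time. A functor to \<open>BV\<close> sends identities to \<open>1\<close> and composites to
  products, so its value on a path is forced to be the product of the values of the rules, the last
  rule leftmost (\<open>functor_eq_path_cert\<close>). The predicate \<open>Sound\<close> is closed under exactly the
  operations that build paths, and the certificates that it asserts are multiplied in the same
  order, so that the same induction gives soundness of \<open>w\<close> with certificate \<open>\<beta>(w)\<close>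
  (\<open>path_cert_relation\<close>). Existence holds because the product of a concatenation of lists is the
  product of the two products: the formula forced on a functor does define one
  (\<open>is_functor_path_functor\<close>).

  The guard of a path is determined by the path, so soundness of a path on its guard is just a
  relation between paths and elements of \<open>V\<close>.
\<close>

text \<open>
  The step puts the new rule at the start of the path, because arc lists are in the order of
  traversal and grow at their heads.
\<close>

lemma free_category_induct [consumes 2, case_names Id Comp]:
  assumes "wf_digraph R" and "w \<in> Arr (free_category R)"
    and Id: "\<And>x. x \<in> verts R \<Longrightarrow> P (Id (free_category R) x)"
    and Comp: "\<And>r w. \<lbrakk>r \<in> arcs R; w \<in> Arr (free_category R);
        Cod (free_category R) (generator R r) = Dom (free_category R) w; P w\<rbrakk>
        \<Longrightarrow> P (Comp (free_category R) w (generator R r))"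
  shows "P w"
proof -
  interpret wf_digraph R by fact
  have "P (x, p, y)" if "awalk x p y" for x p y
    using that
  proof (induction p arbitrary: x)
    case Nil
    then show ?case using Id[of x] by (auto simp: free_category_def awalk_Nil_iff)
  next
    case (Cons r p)
    then have "r \<in> arcs R" "tail R r = x" "awalk (head R r) p y"
      by (simp_all add: awalk_Cons_iff)
    then show ?case using Comp[of r "(head R r, p, y)"] Cons.IH
      by (simp add: free_category_def generator_def)
  qed
  then show ?thesis using \<open>w \<in> Arr (free_category R)\<close> by (auto simp: free_category_def)
qed

definition path_cert :: "('r \<Rightarrow> 'v::monoid_mult) \<Rightarrow> ('x, 'r) path \<Rightarrow> 'v" where
  "path_cert \<beta> = (\<lambda>(x, p, y). prod_list (map \<beta> (rev p)))"

definition path_functor :: "('x, 'r) pre_digraph \<Rightarrow> ('r \<Rightarrow> 'v::monoid_mult)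
    \<Rightarrow> ('x, ('x, 'r) path, unit, 'v) fmaps" where
  "path_functor R \<beta> = \<lparr>obj_map = (\<lambda>x\<in>verts R. ()),
     arr_map = restrict (path_cert \<beta>) (Arr (free_category R))\<rparr>"

lemma path_cert_Id: "path_cert \<beta> (Id (free_category R) x) = 1"
  by (simp add: path_cert_def free_category_def)

lemma path_cert_generator: "path_cert \<beta> (generator R r) = \<beta> r"
  by (simp add: path_cert_def generator_def)

lemma path_cert_Comp:
  "path_cert \<beta> (Comp (free_category R) w\<^sub>2 w\<^sub>1) = path_cert \<beta> w\<^sub>2 * path_cert \<beta> w\<^sub>1"
  by (simp add: path_cert_def free_category_def split: prod.split)

lemma is_functor_path_functor:
  fixes \<beta> :: "'r \<Rightarrow> 'v::monoid_mult"
  assumes "wf_digraph R"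
  shows "is_functor (free_category R) one_object_cat (path_functor R \<beta>)"
proof -
  interpret source: category "free_category R" by (rule category_free_category) fact
  interpret target: category "one_object_cat :: (unit, 'v) cat" by (rule category_one_object_cat)
  have "Obj (free_category R) = verts R" by (simp add: free_category_def)
  then show ?thesis
    by unfold_locales
      (auto simp: path_functor_def one_object_cat_def path_cert_Id path_cert_Comp
        source.Id_in source.Comp_in)
qed

lemma path_functor_generator:
  assumes "wf_digraph R" "r \<in> arcs R"
  shows "arr_map (path_functor R \<beta>) (generator R r) = \<beta> r"
  using generator_in_free_category(1)[OF assms]
  by (simp add: path_functor_def path_cert_generator)

lemma functor_eq_path_cert:
  assumes "wf_digraph R" and "is_functor (free_category R) one_object_cat B"
    and gen: "\<And>r. r \<in> arcs R \<Longrightarrow> arr_map B (generator R r) = \<beta> r"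
    and "w \<in> Arr (free_category R)"
  shows "arr_map B w = path_cert \<beta> w"
proof -
  interpret is_functor "free_category R" one_object_cat B by fact
  show ?thesis using \<open>wf_digraph R\<close> \<open>w \<in> Arr (free_category R)\<close>
  proof (induction rule: free_category_induct)
    case (Id x)
    moreover have "x \<in> Obj (free_category R)" using Id by (simp add: free_category_def)
    ultimately show ?case by (simp add: map_Id path_cert_Id one_object_cat_def)
  next
    case (Comp r w)
    then show ?case
      using generator_in_free_category(1)[OF \<open>wf_digraph R\<close> Comp.hyps(1)]
      by (simp add: map_Comp path_cert_Comp path_cert_generator gen one_object_cat_def)
  qed
qed

text \<open>
  On objects there is no choice, since \<open>BV\<close> has only one; on arrows the value is forced.
\<close>

lemma functor_eq_path_functor:
  assumes "wf_digraph R" and "is_functor (free_category R) one_object_cat B"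
    and "\<And>r. r \<in> arcs R \<Longrightarrow> arr_map B (generator R r) = \<beta> r"
  shows "B = path_functor R \<beta>"
proof -
  interpret is_functor "free_category R" one_object_cat B by fact
  have "obj_map B = obj_map (path_functor R \<beta>)" by (simp add: fun_eq_iff)
  moreover have "arr_map B = arr_map (path_functor R \<beta>)"
  proof
    fix w
    show "arr_map B w = arr_map (path_functor R \<beta>) w"
      using functor_eq_path_cert[OF assms] PiE_arb[OF arr_map_in]
      by (cases "w \<in> Arr (free_category R)") (simp_all add: path_functor_def)
  qed
  ultimately show ?thesis by (cases B; cases "path_functor R \<beta>") simp
qed

text \<open>
  Soundness, with \<open>S w v\<close> standing for soundness of \<open>w\<close> on its guard. Every path is built from
  identities and generators by composition, and \<open>path_cert\<close> multiplies along this construction in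
  the order in which \<open>S\<close> composes.
\<close>

lemma path_cert_relation:
  assumes "wf_digraph R"
    and Id: "\<And>x. x \<in> verts R \<Longrightarrow> S (Id (free_category R) x) 1"
    and gen: "\<And>r. r \<in> arcs R \<Longrightarrow> S (generator R r) (\<beta> r)"
    and Comp: "\<And>w\<^sub>1 w\<^sub>2 v\<^sub>1 v\<^sub>2. \<lbrakk>w\<^sub>1 \<in> Arr (free_category R); w\<^sub>2 \<in> Arr (free_category R);
        Cod (free_category R) w\<^sub>1 = Dom (free_category R) w\<^sub>2; S w\<^sub>1 v\<^sub>1; S w\<^sub>2 v\<^sub>2\<rbrakk>
        \<Longrightarrow> S (Comp (free_category R) w\<^sub>2 w\<^sub>1) (v\<^sub>2 * v\<^sub>1)"
    and "w \<in> Arr (free_category R)"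
  shows "S w (path_cert \<beta> w)"
  using \<open>wf_digraph R\<close> \<open>w \<in> Arr (free_category R)\<close>
proof (induction rule: free_category_induct)
  case (Id x)
  then show ?case by (simp add: path_cert_Id assms(2))
next
  case (Comp r w)
  then show ?case
    using generator_in_free_category(1)[OF \<open>wf_digraph R\<close> Comp.hyps(1)]
    by (simp add: path_cert_Comp path_cert_generator gen assms(4))
qed

theorem theorem25p2:
  fixes R :: "('x, 'r) pre_digraph"
    and St :: "'x \<Rightarrow> 's set"
    and act :: "'r \<Rightarrow> ('s \<rightharpoonup> 's)"
    and \<beta> :: "'r \<Rightarrow> 'v::ordered_error_algebra"
  assumes "guarded_rules R St act"
  defines "FR \<equiv> free_category R"
    and "extends_gen \<equiv> (\<lambda>B. is_functor (free_category R) one_object_cat B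
           \<and> (\<forall>r \<in> arcs R. arr_map B (generator R r) = \<beta> r))"
  shows "(\<exists>!B. extends_gen B) \<and>
    (\<forall>B Sound.
       extends_gen B \<longrightarrow>
       (\<forall>x \<in> verts R. Sound (Id FR x) (guard R St act (Id FR x)) 1) \<longrightarrow>
       (\<forall>r \<in> arcs R. Sound (generator R r) (guard R St act (generator R r)) (\<beta> r)) \<longrightarrow>
       (\<forall>w\<^sub>1 \<in> Arr FR. \<forall>w\<^sub>2 \<in> Arr FR. \<forall>v\<^sub>1 v\<^sub>2.
          Cod FR w\<^sub>1 = Dom FR w\<^sub>2 \<longrightarrow>
          Sound w\<^sub>1 (guard R St act w\<^sub>1) v\<^sub>1 \<longrightarrow>
          Sound w\<^sub>2 (guard R St act w\<^sub>2) v\<^sub>2 \<longrightarrow>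
          Sound (Comp FR w\<^sub>2 w\<^sub>1) (guard R St act (Comp FR w\<^sub>2 w\<^sub>1)) (v\<^sub>2 * v\<^sub>1)) \<longrightarrow>
       (\<forall>x \<in> verts R. Sound (Id FR x) (guard R St act (Id FR x)) 1) \<and>
       (\<forall>x p y. (x, p, y) \<in> Arr FR \<longrightarrow> p \<noteq> [] \<longrightarrow>
          arr_map B (x, p, y) = prod_list (map \<beta> (rev p)) \<and>
          Sound (x, p, y) (guard R St act (x, p, y)) (arr_map B (x, p, y))))"
proof -
  have wf: "wf_digraph R" using assms(1) by (rule guarded_rules.axioms(1))
  have "\<exists>!B. extends_gen B"
    unfolding extends_gen_def
    using is_functor_path_functor[OF wf, of \<beta>] path_functor_generator[OF wf, of _ \<beta>]
      functor_eq_path_functor[OF wf, of _ \<beta>]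
    by (intro ex1I[of _ "path_functor R \<beta>"]) blast+
  moreover have "arr_map B (x, p, y) = prod_list (map \<beta> (rev p)) \<and>
      Sound (x, p, y) (guard R St act (x, p, y)) (arr_map B (x, p, y))"
    if B: "extends_gen B"
      and Id: "\<forall>x \<in> verts R. Sound (Id FR x) (guard R St act (Id FR x)) 1"
      and gen: "\<forall>r \<in> arcs R. Sound (generator R r) (guard R St act (generator R r)) (\<beta> r)"
      and Comp: "\<forall>w\<^sub>1 \<in> Arr FR. \<forall>w\<^sub>2 \<in> Arr FR. \<forall>v\<^sub>1 v\<^sub>2.
          Cod FR w\<^sub>1 = Dom FR w\<^sub>2 \<longrightarrow>
          Sound w\<^sub>1 (guard R St act w\<^sub>1) v\<^sub>1 \<longrightarrow>
          Sound w\<^sub>2 (guard R St act w\<^sub>2) v\<^sub>2 \<longrightarrow>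
          Sound (Comp FR w\<^sub>2 w\<^sub>1) (guard R St act (Comp FR w\<^sub>2 w\<^sub>1)) (v\<^sub>2 * v\<^sub>1)"
      and path: "(x, p, y) \<in> Arr FR"
    for B x p y and Sound :: "('x, 'r) path \<Rightarrow> 's set \<Rightarrow> 'v \<Rightarrow> bool"
  proof -
    have "arr_map B (x, p, y) = path_cert \<beta> (x, p, y)"
      using functor_eq_path_cert[OF wf, of B \<beta>] B path by (simp add: extends_gen_def FR_def)
    moreover have "Sound (x, p, y) (guard R St act (x, p, y)) (path_cert \<beta> (x, p, y))"
      using Id gen Comp path
      by (intro path_cert_relation[OF wf, where S = "\<lambda>w. Sound w (guard R St act w)"])
        (simp_all add: FR_def)
    ultimately show ?thesis by (simp add: path_cert_def)
  qed
  ultimately show ?thesis by blast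
qed

end
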